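(* Let $n$ and $r$ be positive integers such that $n\ge r+1\ge 3$. Then $\mathrm{CC}(n,r)\le \mathrm{N}(n,r)$, where $$\mathrm{N}(n,r) := \sum_{i=0}^{\left\lceil\frac{n-r}{2}\right\rceil-1}(n-r-2i)\binom{r-2+2i}{r-2} + \left\lceil\frac{n-r}{2}\right\rceil-1 + \delta_0\,\mathrm{C}(n-2,r-2),$$ and $\delta_0=0$ if $n-r$ is odd, $\delta_0=1$ if $n-r$ is even.
   Context: For integers $n\ge r+1$, $r\ge 0$, an $(n,r+1,r)$-covering is a family $\mathcal{B}$ of $(r+1)$-subsets of $\{1,\ldots,n\}$, called blocks, such that each $r$-subset of $\{1,\ldots,n\}$ is contained in at least one block. Its size is the number of blocks. The graph $G(\mathcal{B})$ has the blocks as vertices, and two distinct blocks are adjacent if they have an $r$-subset in common (i.e. their intersection has exactly $r$ elements). The covering is connected if $G(\mathcal{B})$ is connected. $\mathrm{C}(n,r)$ denotes the minimum size of an $(n,r+1,r)$-covering (so $\mathrm{C}(n,0)=1$), and $\mathrm{CC}(n,r)$ denotes the minimum size of a connected $(n,r+1,r)$-covering. When $n-r$ is odd, the term $\delta_0\,\mathrm{C}(n-2,r-2)$ is $0$. *)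

theory Defs
  imports Complex_Main "Graph_Theory.Digraph_Component"
begin

text \<open>An \<open>(n,r+1,r)\<close>-covering: the point set is \<open>{1..n}\<close>.\<close>

definition covering :: "nat \<Rightarrow> nat \<Rightarrow> nat set set \<Rightarrow> bool" where
  "covering n r \<B> \<longleftrightarrow>
     (\<forall>B\<in>\<B>. B \<subseteq> {1..n} \<and> card B = r + 1) \<and>
     (\<forall>R. R \<subseteq> {1..n} \<and> card R = r \<longrightarrow> (\<exists>B\<in>\<B>. R \<subseteq> B))"

text \<open>The undirected graph \<open>G(\<B>)\<close>, represented as a symmetric loop-free digraph.\<close>

definition covering_graph :: "nat \<Rightarrow> nat set set \<Rightarrow> nat set pair_pre_digraph" where
  "covering_graph r \<B> =
     \<lparr> pverts = \<B>,
       parcs = {(A, B). A \<in> \<B> \<and> B \<in> \<B> \<and> A \<noteq> B \<and> card (A \<inter> B) = r} \<rparr>"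

text \<open>The qualified name selects graph connectedness over the topological \<open>connected\<close>.\<close>

definition connected_covering :: "nat \<Rightarrow> nat \<Rightarrow> nat set set \<Rightarrow> bool" where
  "connected_covering n r \<B> \<longleftrightarrow>
     covering n r \<B> \<and> Digraph_Component.connected (with_proj (covering_graph r \<B>))"

text \<open>
  For \<open>n \<ge> r + 1\<close> the family of all \<open>(r+1)\<close>-subsets of \<open>{1..n}\<close> is a connected covering,
  so both minima below are over nonempty sets; every covering is finite, so \<open>card\<close> is the
  true size.
\<close>

definition C :: "nat \<Rightarrow> nat \<Rightarrow> nat" where
  "C n r = (LEAST k. \<exists>\<B>. covering n r \<B> \<and> card \<B> = k)"

definition CC :: "nat \<Rightarrow> nat \<Rightarrow> nat" where
  "CC n r = (LEAST k. \<exists>\<B>. connected_covering n r \<B> \<and> card \<B> = k)"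

text \<open>
  For \<open>n \<ge> r + 1 \<ge> 3\<close> none of the subtractions on \<open>nat\<close> truncates: the ceiling is at
  least \<open>1\<close>, and \<open>2 * i < n - r\<close> for every summation index. The factor
  \<open>of_bool (even (n - r))\<close> is \<open>\<delta>\<^sub>0\<close>.
\<close>

definition N :: "nat \<Rightarrow> nat \<Rightarrow> nat" where
  "N n r =
     (\<Sum>i = 0..nat \<lceil>real (n - r) / 2\<rceil> - 1. (n - r - 2 * i) * ((r - 2 + 2 * i) choose (r - 2)))
     + (nat \<lceil>real (n - r) / 2\<rceil> - 1)
     + of_bool (even (n - r)) * C (n - 2) (r - 2)"

end

theory Submission
  imports Defs
begin

text \<open>
  Put \<open>m = r - 2\<close> and split the points above \<open>m\<close> into consecutive pairs
  \<open>{m + 2i + 1, m + 2i + 2}\<close>. Level \<open>i\<close> consists of the blocks made of an \<open>m\<close>-set below the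
  \<open>i\<close>-th pair, the pair itself, and one point above it; there are at most
  \<open>(n - r - 2i) * binomial (m + 2i) m\<close> of them. The levels run over \<open>i = 0, ..., q\<close> with
  \<open>q = \<lceil>(n - r) / 2\<rceil> - 1\<close>, that is, over all pairs that have a point above them.

  Every \<open>r\<close>-set is covered by the level whose pair contains its second largest element, unless
  no point lies above that pair. The exception occurs only if \<open>n - r\<close> is even, and then for the
  \<open>r\<close>-sets that contain both \<open>n - 1\<close> and \<open>n\<close>. These are covered by adding \<open>{n - 1, n}\<close> to each
  block of a minimum \<open>(n - 2, r - 1, r - 2)\<close>-covering. This is the term \<open>\<delta>\<^sub>0 C(n - 2, r - 2)\<close>.
  Coverage by the levels is \<open>level_covers\<close>.

  For connectivity, a level is connected because \<open>m\<close>-sets can be moved into each other by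
  exchanging one element at a time (\<open>linked_exchange\<close>, \<open>linked_hub\<close>). Consecutive levels are joined by one extra
  block each, called a bridge (\<open>bridge_linked_hubs\<close>), which accounts for the summand \<open>\<lceil>(n - r) / 2\<rceil> - 1\<close>. Finally,
  a block \<open>B \<union> {n - 1, n}\<close> needs no bridge: its \<open>r\<close>-subset \<open>B \<union> {n - 1}\<close> misses \<open>n\<close>, so it
  already lies in a block of some level.
\<close>

section \<open>Connectivity of families of blocks\<close>

text \<open>
  Steps are taken between blocks that share at least \<open>r\<close> points, rather than exactly \<open>r\<close>, so
  that a step from a block to itself is allowed. Between distinct blocks of size \<open>r + 1\<close> the two
  conditions agree, and the weaker one spares a case distinction whenever two descriptions might
  yield the same block.
\<close>

definition linked :: "nat \<Rightarrow> 'a set set \<Rightarrow> ('a set \<times> 'a set) set" where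
  "linked r F = {(A, B). A \<in> F \<and> B \<in> F \<and> r \<le> card (A \<inter> B)}\<^sup>*"

lemma linked_refl: "(A, A) \<in> linked r F"
  by (simp add: linked_def)

lemma linked_trans: "(A, B) \<in> linked r F \<Longrightarrow> (B, D) \<in> linked r F \<Longrightarrow> (A, D) \<in> linked r F"
  unfolding linked_def by (rule rtrancl_trans)

lemma linked_sym: "(A, B) \<in> linked r F \<Longrightarrow> (B, A) \<in> linked r F"
  unfolding linked_def by (rule symD[OF sym_rtrancl]) (auto simp: sym_def Int_commute)

lemma linked_common_subset:
  assumes "A \<in> F" "B \<in> F" "finite A" "R \<subseteq> A" "R \<subseteq> B" "r \<le> card R"
  shows "(A, B) \<in> linked r F"
proof -
  have "card R \<le> card (A \<inter> B)"
    using assms by (intro card_mono) auto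
  then show ?thesis
    unfolding linked_def using assms by (intro r_into_rtrancl) auto
qed

text \<open>
  Since linking is symmetric and transitive, connectedness of \<open>G(\<B>)\<close> reduces to linking every
  block to one reference block.
\<close>

lemma connected_coveringI:
  assumes cov: "covering n r F" and H: "H \<in> F"
    and link: "\<And>A. A \<in> F \<Longrightarrow> (A, H) \<in> linked r F"
  shows "connected_covering n r F"
proof -
  let ?E = "(parcs (covering_graph r F))\<^sup>s"
  have fin: "finite A" "card A = r + 1" if "A \<in> F" for A
    using cov that by (auto simp: covering_def intro: finite_subset)
  have adj: "A = B \<or> (A, B) \<in> ?E"
    if AB: "A \<in> F" "B \<in> F" "r \<le> card (A \<inter> B)" for A B
  proof (cases "A = B")
    case False
    have "\<not> A \<subseteq> B"
      using card_subset_eq[of B A] fin AB False by auto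
    then have "card (A \<inter> B) < card A"
      using fin AB by (intro psubset_card_mono) auto
    then have "card (A \<inter> B) = r"
      using fin AB by simp
    then show ?thesis
      using AB by (simp add: covering_graph_def symcl_def)
  qed simp
  have reach: "(A, B) \<in> rtrancl_on F ?E" if "(A, B) \<in> linked r F" "A \<in> F" for A B
    using that(1) unfolding linked_def
  proof (induction rule: rtrancl_induct)
    case base
    show ?case using that(2) by simp
  next
    case (step B D)
    then have "B \<in> F" "D \<in> F" "B = D \<or> (B, D) \<in> ?E"
      using adj[of B D] by auto
    then show ?case
      using step.IH by (auto intro: rtrancl_on_into_rtrancl_on)
  qed
  have "(A, B) \<in> rtrancl_on F ?E" if "A \<in> F" "B \<in> F" for A B
    using that by (intro reach linked_trans[OF link linked_sym[OF link]])
  moreover have "pverts (covering_graph r F) = F"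
    by (simp add: covering_graph_def)
  ultimately have "Digraph_Component.connected (with_proj (covering_graph r F))"
    using H by (auto simp: connected_conv)
  with cov show ?thesis
    by (simp add: connected_covering_def)
qed

text \<open>
  The Johnson graph on the \<open>k\<close>-subsets of a finite set is connected: replacing an element of
  \<open>A - B\<close> by one of \<open>B - A\<close> brings \<open>A\<close> closer to \<open>B\<close>, and the two sets involved share \<open>k - 1\<close>
  points. Padding all sets with the same \<open>K\<close> raises the intersection to \<open>k - 1 + card K\<close>.
\<close>

lemma linked_exchange:
  assumes "finite S" "finite K" "K \<inter> S = {}"
    and F: "\<And>Z. Z \<subseteq> S \<Longrightarrow> card Z = k \<Longrightarrow> Z \<union> K \<in> F"
    and "r < k + card K"
    and "A \<subseteq> S" "card A = k" "B \<subseteq> S" "card B = k"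
  shows "(A \<union> K, B \<union> K) \<in> linked r F"
  using assms(6,7)
proof (induction "card (A - B)" arbitrary: A)
  case 0
  moreover have fin: "finite A" "finite B"
    using 0 assms finite_subset[OF _ \<open>finite S\<close>] by auto
  ultimately have "A \<subseteq> B" by auto
  then have "A = B"
    using card_subset_eq[OF fin(2)] 0 \<open>card B = k\<close> by auto
  then show ?case by (simp add: linked_refl)
next
  case (Suc d)
  have fin: "finite A" "finite B"
    using Suc assms finite_subset[OF _ \<open>finite S\<close>] by auto
  obtain a where a: "a \<in> A" "a \<notin> B"
    using Suc(2) by (metis Diff_iff card_eq_0_iff ex_in_conv nat.distinct(1))
  have "\<not> B \<subseteq> A"
    using a card_subset_eq[OF fin(1), of B] Suc(4) \<open>card B = k\<close> by auto
  then obtain b where b: "b \<in> B" "b \<notin> A" by blast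
  define A' where "A' = insert b (A - {a})"
  have sub: "A' \<subseteq> S" and cA': "card A' = k"
    using Suc(3,4) a b \<open>B \<subseteq> S\<close> fin card_Suc_Diff1[of A a] by (auto simp: A'_def)
  have "A' - B = (A - B) - {a}"
    using b by (auto simp: A'_def)
  then have "card (A' - B) = d"
    using Suc(2) a by simp
  then have "(A' \<union> K, B \<union> K) \<in> linked r F"
    using Suc(1)[of A'] sub cA' by simp
  moreover have "(A \<union> K, A' \<union> K) \<in> linked r F"
  proof (rule linked_common_subset)
    show "A \<union> K \<in> F" "A' \<union> K \<in> F"
      using F Suc(3,4) sub cA' by auto
    show "finite (A \<union> K)" using fin assms by simp
    show "A - {a} \<union> K \<subseteq> A \<union> K" "A - {a} \<union> K \<subseteq> A' \<union> K"
      by (auto simp: A'_def)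
    have "card (A - {a} \<union> K) = card (A - {a}) + card K"
      using fin assms Suc(3) by (intro card_Un_disjoint) auto
    then show "r \<le> card (A - {a} \<union> K)"
      using \<open>r < k + card K\<close> a fin Suc(4) by (simp add: card_Diff_singleton)
  qed
  ultimately show ?case by (rule linked_trans[rotated])
qed

section \<open>Levels and bridges\<close>

definition level :: "nat \<Rightarrow> nat \<Rightarrow> nat \<Rightarrow> nat set set" where
  "level n m i = {A \<union> {m + 2*i + 1, m + 2*i + 2, x} | A x.
     A \<subseteq> {1..m + 2*i} \<and> card A = m \<and> x \<in> {m + 2*i + 3..n}}"

text \<open>
  The reference block of level \<open>i\<close>: it uses the smallest \<open>m\<close>-set and the smallest point above
  the pair.
\<close>

definition hub :: "nat \<Rightarrow> nat \<Rightarrow> nat set" where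
  "hub m i = {1..m} \<union> {m + 2*i + 1, m + 2*i + 2, m + 2*i + 3}"

text \<open>
  The \<open>m\<close>-set \<open>{1..m}\<close> with the \<open>i\<close>-th pair and the upper point of the pair before it. It shares
  the \<open>i\<close>-th pair with \<open>hub m i\<close>, and the points \<open>m + 2i\<close> and \<open>m + 2i + 1\<close> with \<open>hub m (i - 1)\<close>.
\<close>

definition bridge :: "nat \<Rightarrow> nat \<Rightarrow> nat set" where
  "bridge m i = {1..m} \<union> {m + 2*i, m + 2*i + 1, m + 2*i + 2}"

lemma levelI:
  "A \<subseteq> {1..m + 2*i} \<Longrightarrow> card A = m \<Longrightarrow> m + 2*i + 3 \<le> x \<Longrightarrow> x \<le> n \<Longrightarrow>
    A \<union> {m + 2*i + 1, m + 2*i + 2, x} \<in> level n m i"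
  unfolding level_def by auto

lemma hub_in_level: "m + 2*i + 3 \<le> n \<Longrightarrow> hub m i \<in> level n m i"
  unfolding hub_def by (rule levelI) auto

lemma level_block:
  assumes "D \<in> level n m i"
  shows "D \<subseteq> {1..n}" "card D = m + 3"
proof -
  obtain A x where D: "D = A \<union> {m + 2*i + 1, m + 2*i + 2, x}" and A: "A \<subseteq> {1..m + 2*i}" "card A = m"
    and x: "m + 2*i + 3 \<le> x" "x \<le> n"
    using assms by (auto simp: level_def)
  have "A \<subseteq> {1..n}" using A(1) by (rule order_trans) (use x in auto)
  then show "D \<subseteq> {1..n}" using D x by auto
  have "finite A" using A by (auto intro: finite_subset)
  then have "card D = card A + card {m + 2*i + 1, m + 2*i + 2, x}"
    unfolding D using \<open>finite A\<close> subsetD[OF A(1)] x by (intro card_Un_disjoint) force+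
  then show "card D = m + 3" using A x by simp
qed

lemma bridge_block:
  assumes "1 \<le> i" "m + 2*i + 2 \<le> n"
  shows "bridge m i \<subseteq> {1..n}" "card (bridge m i) = m + 3"
proof -
  show "bridge m i \<subseteq> {1..n}" using assms by (auto simp: bridge_def)
  have "card (bridge m i) = card {1..m} + card {m + 2*i, m + 2*i + 1, m + 2*i + 2}"
    unfolding bridge_def using assms by (intro card_Un_disjoint) auto
  then show "card (bridge m i) = m + 3" by simp
qed

lemma finite_level: "finite (level n m i)"
  by (rule finite_subset[of _ "Pow {1..n}"]) (use level_block(1) in blast, simp)

lemma card_level: "card (level n m i) \<le> (n - (m + 2) - 2*i) * ((m + 2*i) choose m)"
proof -
  let ?P = "{A. A \<subseteq> {1..m + 2*i} \<and> card A = m} \<times> {m + 2*i + 3..n}"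
  have "level n m i \<subseteq> (\<lambda>(A, x). A \<union> {m + 2*i + 1, m + 2*i + 2, x}) ` ?P"
  proof
    fix D assume "D \<in> level n m i"
    then obtain A x where "D = A \<union> {m + 2*i + 1, m + 2*i + 2, x}" "(A, x) \<in> ?P"
      unfolding level_def by auto
    then show "D \<in> (\<lambda>(A, x). A \<union> {m + 2*i + 1, m + 2*i + 2, x}) ` ?P"
      by (intro image_eqI[of _ _ "(A, x)"]) simp_all
  qed
  then have "card (level n m i) \<le> card ?P"
    by (intro surj_card_le) auto
  also have "\<dots> = ((m + 2*i) choose m) * card {m + 2*i + 3..n}"
    using n_subsets[of "{1..m + 2*i}" m] by (simp add: card_cartesian_product)
  also have "card {m + 2*i + 3..n} = n - (m + 2) - 2*i" by simp
  finally show ?thesis by (simp add: mult.commute)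
qed

text \<open>
  The \<open>m\<close>-set of the block is first moved to \<open>{1..m}\<close>, keeping the top point. The top point can
  then be changed in one step, as \<open>{1..m}\<close> and the pair together are \<open>m + 2\<close> common points.
\<close>

lemma linked_hub:
  assumes F: "level n m i \<subseteq> F" and D: "D \<in> level n m i"
  shows "(D, hub m i) \<in> linked (m + 2) F"
proof -
  let ?p = "{m + 2*i + 1, m + 2*i + 2}"
  obtain A x where DA: "D = A \<union> {m + 2*i + 1, m + 2*i + 2, x}" and A: "A \<subseteq> {1..m + 2*i}" "card A = m"
    and x: "m + 2*i + 3 \<le> x" "x \<le> n"
    using D by (auto simp: level_def)
  let ?E = "{1..m} \<union> {m + 2*i + 1, m + 2*i + 2, x}"
  have E: "?E \<in> level n m i" using x by (intro levelI) auto
  have "(D, ?E) \<in> linked (m + 2) F"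
    unfolding DA
  proof (rule linked_exchange[where S = "{1..m + 2*i}" and k = m])
    fix Z assume "Z \<subseteq> {1..m + 2*i}" "card Z = m"
    then show "Z \<union> {m + 2*i + 1, m + 2*i + 2, x} \<in> F"
      using levelI x F by blast
  qed (use A x in auto)
  moreover have "(?E, hub m i) \<in> linked (m + 2) F"
  proof (rule linked_common_subset[where R = "{1..m} \<union> ?p"])
    show "?E \<in> F" using E F by auto
    show "hub m i \<in> F" using hub_in_level[of m i n] x F by auto
    have "card ({1..m} \<union> ?p) = card {1..m} + card ?p"
      by (intro card_Un_disjoint) auto
    then show "m + 2 \<le> card ({1..m} \<union> ?p)" by simp
  qed (auto simp: hub_def)
  ultimately show ?thesis by (rule linked_trans)
qed

lemma bridge_linked_hubs:
  assumes "1 \<le> i" "bridge m i \<in> F"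
  shows "hub m i \<in> F \<Longrightarrow> (bridge m i, hub m i) \<in> linked (m + 2) F"
    and "hub m (i - 1) \<in> F \<Longrightarrow> (bridge m i, hub m (i - 1)) \<in> linked (m + 2) F"
proof -
  have card2: "m + 2 \<le> card ({1..m} \<union> {a, b})" if "m < a" "a < b" for a b :: nat
    using card_Un_disjoint[of "{1..m}" "{a, b}"] that by auto
  show "(bridge m i, hub m i) \<in> linked (m + 2) F" if "hub m i \<in> F"
    using assms that card2[of "m + 2*i + 1" "m + 2*i + 2"]
    by (intro linked_common_subset[where R = "{1..m} \<union> {m + 2*i + 1, m + 2*i + 2}"])
      (auto simp: bridge_def hub_def)
  show "(bridge m i, hub m (i - 1)) \<in> linked (m + 2) F" if "hub m (i - 1) \<in> F"
    using assms that card2[of "m + 2*i" "m + 2*i + 1"]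
    by (intro linked_common_subset[where R = "{1..m} \<union> {m + 2*i, m + 2*i + 1}"])
      (auto simp: bridge_def hub_def)
qed

lemma hubs_linked:
  assumes "\<And>i. i \<le> q \<Longrightarrow> hub m i \<in> F" "\<And>i. 1 \<le> i \<Longrightarrow> i \<le> q \<Longrightarrow> bridge m i \<in> F" "i \<le> q"
  shows "(hub m i, hub m 0) \<in> linked (m + 2) F"
  using assms(3)
proof (induction i)
  case 0
  show ?case by (rule linked_refl)
next
  case (Suc i)
  then have "(hub m (Suc i), hub m i) \<in> linked (m + 2) F"
    using bridge_linked_hubs[of "Suc i" m F] assms(1)[of i] assms(1,2)[of "Suc i"]
    by (auto intro: linked_trans[OF linked_sym])
  then show ?case
    using Suc by (auto intro: linked_trans)
qed

section \<open>Coverage by the levels\<close>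

text \<open>
  Let \<open>y\<close> be the second largest element of \<open>R\<close>. As \<open>m + 1\<close> elements of \<open>R\<close> are at most \<open>y\<close>, it
  belongs to some pair, and at most \<open>m\<close> elements of \<open>R\<close> lie below that pair; they extend to an
  \<open>m\<close>-set there. At most one element of \<open>R\<close> lies above the \<open>q\<close>-th pair, hence not \<open>y\<close>, so the pair of \<open>y\<close> is one of the first \<open>q + 1\<close>.
\<close>

lemma level_covers:
  assumes R: "R \<subseteq> {1..n}" "card R = m + 2"
    and q: "m + 2*q + 3 \<le> n" and one: "card (R \<inter> {m + 2*q + 3..n}) \<le> 1"
  shows "\<exists>i\<le>q. \<exists>D\<in>level n m i. R \<subseteq> D"
proof -
  have finR: "finite R" using R by (auto intro: finite_subset)
  have "R \<noteq> {}" using R by auto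
  define x where "x = Max R"
  have x: "x \<in> R" "\<And>z. z \<in> R \<Longrightarrow> z \<le> x"
    using finR \<open>R \<noteq> {}\<close> by (auto simp: x_def)
  have cRx: "card (R - {x}) = m + 1" using R x finR by simp
  then have "R - {x} \<noteq> {}" by (metis card.empty add_is_0 one_neq_zero)
  define y where "y = Max (R - {x})"
  have y: "y \<in> R" "y \<noteq> x" "\<And>z. z \<in> R \<Longrightarrow> z \<noteq> x \<Longrightarrow> z \<le> y"
    using finR \<open>R - {x} \<noteq> {}\<close> Max_in[of "R - {x}"] by (auto simp: y_def)
  have yx: "y < x" using x y by (simp add: le_neq_implies_less)
  have "R - {x} \<subseteq> {1..y}" using R(1) y(3) by fastforce
  then have "m + 1 \<le> y"
    using card_mono[of "{1..y}" "R - {x}"] cRx by simp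
  define i where "i = (y - (m + 1)) div 2"
  have yi: "y = m + 2*i + 1 \<or> y = m + 2*i + 2"
    using \<open>m + 1 \<le> y\<close> unfolding i_def by presburger
  have "i \<le> q"
  proof (rule ccontr)
    assume "\<not> i \<le> q"
    then have "{x, y} \<subseteq> R \<inter> {m + 2*q + 3..n}"
      using x y yx yi R by auto
    then have "card {x, y} \<le> 1"
      using card_mono[of "R \<inter> {m + 2*q + 3..n}" "{x, y}"] one by simp
    then show False using yx by simp
  qed
  let ?a = "m + 2*i + 1" and ?b = "m + 2*i + 2"
  let ?R = "R - {x} - {?a, ?b}"
  have subR: "?R \<subseteq> {1..m + 2*i}"
  proof
    fix z assume "z \<in> ?R"
    then have "z \<le> y" "z \<noteq> ?a" "z \<noteq> ?b" "1 \<le> z" using y R by auto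
    then show "z \<in> {1..m + 2*i}" using yi by auto
  qed
  have "?R \<subseteq> R - {x} - {y}" using yi by auto
  then have "card ?R \<le> card (R - {x} - {y})"
    using finR by (intro card_mono) auto
  also have "\<dots> = m" using cRx y finR by simp
  finally obtain A where A: "?R \<subseteq> A" "A \<subseteq> {1..m + 2*i}" "card A = m"
    using exists_subset_between[of ?R m "{1..m + 2*i}"] subR by auto
  \<comment> \<open>The largest element \<open>x\<close> is the top point of the block, unless \<open>x\<close> is itself the upper point
    of the pair; then any point above the pair serves.\<close>
  let ?x = "max x (m + 2*i + 3)"
  have "x \<le> n" using x R by auto
  then have "A \<union> {?a, ?b, ?x} \<in> level n m i"
    using A q \<open>i \<le> q\<close> by (intro levelI) auto
  moreover have "R \<subseteq> A \<union> {?a, ?b, ?x}"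
  proof
    fix z assume "z \<in> R"
    then consider "z \<in> ?R" | "z \<in> {?a, ?b}" | "z = x" by blast
    then show "z \<in> A \<union> {?a, ?b, ?x}"
    proof cases
      case 3
      have "x = ?b \<or> x = ?x" using yx yi by auto
      then show ?thesis using 3 by auto
    qed (use A in auto)
  qed
  ultimately show ?thesis using \<open>i \<le> q\<close> by blast
qed

section \<open>The tower of levels\<close>

definition tower :: "nat \<Rightarrow> nat \<Rightarrow> nat \<Rightarrow> nat set set" where
  "tower n m q = (\<Union>i\<in>{0..q}. level n m i) \<union> bridge m ` {1..q}"

lemma level_subset_tower: "i \<le> q \<Longrightarrow> level n m i \<subseteq> tower n m q"
  unfolding tower_def by auto

lemma hub_in_tower: "m + 2*q + 3 \<le> n \<Longrightarrow> i \<le> q \<Longrightarrow> hub m i \<in> tower n m q"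
  using hub_in_level[of m i n] level_subset_tower[of i q n m] by auto

lemma finite_tower: "finite (tower n m q)"
  by (simp add: tower_def finite_level)

lemma tower_block:
  assumes "m + 2*q + 3 \<le> n" "D \<in> tower n m q"
  shows "D \<subseteq> {1..n} \<and> card D = m + 3"
proof -
  consider i where "D \<in> level n m i" | i where "1 \<le> i" "i \<le> q" "D = bridge m i"
    using assms(2) by (auto simp: tower_def)
  then show ?thesis
  proof cases
    case (1 i)
    then show ?thesis using level_block by blast
  next
    case (2 i)
    then show ?thesis using bridge_block[of i m n] assms(1) by simp
  qed
qed

lemma card_tower:
  "card (tower n m q) \<le> (\<Sum>i = 0..q. (n - (m + 2) - 2*i) * ((m + 2*i) choose m)) + q"
proof -
  have "card (\<Union>i\<in>{0..q}. level n m i) \<le> (\<Sum>i = 0..q. card (level n m i))"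
    by (rule card_UN_le) simp
  also have "\<dots> \<le> (\<Sum>i = 0..q. (n - (m + 2) - 2*i) * ((m + 2*i) choose m))"
    by (intro sum_mono card_level)
  finally have 1: "card (\<Union>i\<in>{0..q}. level n m i) \<le> \<dots>" .
  have "card (bridge m ` {1..q}) \<le> q"
    using card_image_le[of "{1..q}" "bridge m"] by simp
  with 1 have "card (\<Union>i\<in>{0..q}. level n m i) + card (bridge m ` {1..q})
      \<le> (\<Sum>i = 0..q. (n - (m + 2) - 2*i) * ((m + 2*i) choose m)) + q"
    by (rule add_mono)
  then show ?thesis
    unfolding tower_def by (rule order_trans[OF card_Un_le])
qed

lemma tower_linked:
  assumes q: "m + 2*q + 3 \<le> n" and F: "tower n m q \<subseteq> F" and D: "D \<in> tower n m q"
  shows "(D, hub m 0) \<in> linked (m + 2) F"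
proof -
  have hubs: "hub m i \<in> F" if "i \<le> q" for i
    using hub_in_tower[OF q that] F by auto
  have bridges: "bridge m i \<in> F" if "1 \<le> i" "i \<le> q" for i
    using that F by (auto simp: tower_def)
  consider i where "i \<le> q" "D \<in> level n m i" | i where "1 \<le> i" "i \<le> q" "D = bridge m i"
    using D by (auto simp: tower_def)
  then obtain i where i: "i \<le> q" "(D, hub m i) \<in> linked (m + 2) F"
  proof cases
    case (1 i)
    then show ?thesis
      using linked_hub[of n m i F D] level_subset_tower[of i q n m] F that[of i] by auto
  next
    case (2 i)
    then show ?thesis
      using bridge_linked_hubs(1)[of i m F] hubs bridges that[of i] by auto
  qed
  show ?thesis
    by (rule linked_trans[OF i(2) hubs_linked[OF hubs bridges i(1)]])
qed

section \<open>The connected coverings and their sizes\<close>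

lemma CC_le: "connected_covering n r F \<Longrightarrow> CC n r \<le> card F"
  unfolding CC_def by (rule Least_le) auto

lemma minimum_covering_exists:
  assumes "r + 1 \<le> n"
  obtains F where "covering n r F" "card F = C n r"
proof -
  have "covering n r {B. B \<subseteq> {1..n} \<and> card B = r + 1}"
    unfolding covering_def
  proof (intro conjI ballI allI impI)
    fix R :: "nat set" assume R: "R \<subseteq> {1..n} \<and> card R = r"
    then show "\<exists>B\<in>{B. B \<subseteq> {1..n} \<and> card B = r + 1}. R \<subseteq> B"
      using exists_subset_between[of R "r + 1" "{1..n}"] assms by auto
  qed auto
  then have "\<exists>k F. covering n r F \<and> card F = k" by blast
  from LeastI_ex[OF this] show ?thesis
    using that unfolding C_def by blast
qed

text \<open>
  Odd \<open>n - r\<close>: only the point \<open>n\<close> lies above the last pair, so no \<open>r\<close>-set is exceptional.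
\<close>

lemma tower_connected_covering:
  fixes m q :: nat
  defines "n \<equiv> m + 2*q + 3"
  shows "connected_covering n (m + 2) (tower n m q)"
proof (rule connected_coveringI)
  have q: "m + 2*q + 3 \<le> n" by (simp add: n_def)
  show "covering n (m + 2) (tower n m q)"
    unfolding covering_def
  proof (intro conjI ballI allI impI)
    fix R assume R: "R \<subseteq> {1..n} \<and> card R = m + 2"
    have "card (R \<inter> {m + 2*q + 3..n}) \<le> card {n}"
      by (intro card_mono) (auto simp: n_def)
    then have "\<exists>i\<le>q. \<exists>D\<in>level n m i. R \<subseteq> D"
      using R q by (intro level_covers) auto
    then show "\<exists>B\<in>tower n m q. R \<subseteq> B"
      using level_subset_tower by blast
  qed (use tower_block[OF q] in auto)
  show "hub m 0 \<in> tower n m q" by (rule hub_in_tower) (simp_all add: n_def)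
  show "(A, hub m 0) \<in> linked (m + 2) (tower n m q)" if "A \<in> tower n m q" for A
    using tower_linked[OF q _ that] by auto
qed

text \<open>
  Even \<open>n - r\<close>: both \<open>n - 1\<close> and \<open>n\<close> lie above the last pair. The tower covers the \<open>r\<close>-sets that
  miss at least one of them. The same fact links a cap block \<open>B \<union> {n - 1, n}\<close> to the tower, through its
  \<open>r\<close>-subset \<open>B \<union> {n - 1}\<close>.
\<close>

lemma capped_tower_connected_covering:
  fixes m q :: nat
  defines "n \<equiv> m + 2*q + 4"
  assumes G: "covering (n - 2) m G"
  shows "connected_covering n (m + 2) (tower n m q \<union> (\<lambda>B. B \<union> {n - 1, n}) ` G)"
    (is "connected_covering _ _ ?F")
proof (rule connected_coveringI)
  have q: "m + 2*q + 3 \<le> n" by (simp add: n_def)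
  have top: "{m + 2*q + 3..n} = {n - 1, n}" by (auto simp: n_def)
  have n: "n - 1 \<noteq> n" "2 \<le> n" by (auto simp: n_def)
  have G_block: "B \<subseteq> {1..n - 2}" "card B = m + 1" "finite B" if "B \<in> G" for B
    using G that by (auto simp: covering_def intro: finite_subset)
  have G_below: "n - 1 \<notin> B" "n \<notin> B" if "B \<in> G" for B
    using G_block(1)[OF that] n subsetD[of B "{1..n - 2}" n] subsetD[of B "{1..n - 2}" "n - 1"]
    by auto
  have lower: "\<exists>D\<in>tower n m q. R \<subseteq> D"
    if "R \<subseteq> {1..n}" "card R = m + 2" "\<not> {n - 1, n} \<subseteq> R" for R
  proof -
    have "R \<inter> {n - 1, n} \<subseteq> {n - 1} \<or> R \<inter> {n - 1, n} \<subseteq> {n}" using that by auto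
    then have "card (R \<inter> {m + 2*q + 3..n}) \<le> 1"
      unfolding top using card_mono[of "{n - 1}"] card_mono[of "{n}"] by fastforce
    then have "\<exists>i\<le>q. \<exists>D\<in>level n m i. R \<subseteq> D"
      using that q by (intro level_covers) auto
    then show ?thesis using level_subset_tower by blast
  qed
  have block: "D \<subseteq> {1..n} \<and> card D = m + 3" if "D \<in> ?F" for D
    using that
  proof
    assume "D \<in> (\<lambda>B. B \<union> {n - 1, n}) ` G"
    then obtain B where B: "B \<in> G" "D = B \<union> {n - 1, n}" by auto
    have "card D = card B + card {n - 1, n}"
      unfolding B(2) using G_block[OF B(1)] G_below[OF B(1)]
      by (intro card_Un_disjoint) auto
    moreover have "B \<subseteq> {1..n}"
      using G_block(1)[OF B(1)] by (rule order_trans) auto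
    ultimately show ?thesis using B n G_block[OF B(1)] by auto
  qed (rule tower_block[OF q])
  show "covering n (m + 2) ?F"
    unfolding covering_def
  proof (intro conjI ballI allI impI)
    fix R assume R: "R \<subseteq> {1..n} \<and> card R = m + 2"
    show "\<exists>B\<in>?F. R \<subseteq> B"
    proof (cases "{n - 1, n} \<subseteq> R")
      case True
      have "R - {n - 1, n} \<subseteq> {1..n - 2}"
      proof
        fix z assume "z \<in> R - {n - 1, n}"
        then have "1 \<le> z" "z \<le> n" "z \<noteq> n - 1" "z \<noteq> n" using R by auto
        then show "z \<in> {1..n - 2}" by auto
      qed
      moreover have "card (R - {n - 1, n}) = m"
        using True R n by (subst card_Diff_subset) auto
      ultimately obtain B where "B \<in> G" "R - {n - 1, n} \<subseteq> B"
        using G unfolding covering_def by blast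
      then show ?thesis by (intro bexI[of _ "B \<union> {n - 1, n}"]) auto
    next
      case False
      then obtain D where "D \<in> tower n m q" "R \<subseteq> D" using lower[of R] R by auto
      then show ?thesis by blast
    qed
  next
    fix D assume "D \<in> ?F"
    then have "D \<subseteq> {1..n} \<and> card D = m + 3" by (rule block)
    then show "D \<subseteq> {1..n}" "card D = m + 2 + 1" by simp_all
  qed
  show "hub m 0 \<in> ?F" using hub_in_tower[OF q] by auto
  fix D assume D: "D \<in> ?F"
  then show "(D, hub m 0) \<in> linked (m + 2) ?F"
  proof
    assume "D \<in> (\<lambda>B. B \<union> {n - 1, n}) ` G"
    then obtain B where B: "B \<in> G" "D = B \<union> {n - 1, n}" by auto
    let ?R = "insert (n - 1) B"
    have cR: "card ?R = m + 2" using G_block[OF B(1)] G_below[OF B(1)] by simp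
    have "?R \<subseteq> {1..n}" using block[OF D] B by auto
    then obtain E where E: "E \<in> tower n m q" "?R \<subseteq> E"
      using lower[of ?R] cR G_below[OF B(1)] n by auto
    have "(D, E) \<in> linked (m + 2) ?F"
      using D E B cR G_block[OF B(1)]
      by (intro linked_common_subset[where R = ?R]) auto
    moreover have "(E, hub m 0) \<in> linked (m + 2) ?F"
      by (rule tower_linked[OF q _ E(1)]) auto
    ultimately show ?thesis by (rule linked_trans)
  qed (rule tower_linked[OF q], auto)
qed

theorem theorem4p1:
  fixes n r :: nat
  assumes "n > 0" and "r > 0" and "n \<ge> r + 1" and "r + 1 \<ge> 3"
  shows "CC n r \<le> N n r"
proof -
  define m where "m = r - 2"
  define q where "q = nat \<lceil>real (n - r) / 2\<rceil> - 1"
  have r: "r = m + 2" using assms by (simp add: m_def)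
  have card: "card (tower n m q) \<le>
    (\<Sum>i = 0..q. (n - r - 2*i) * ((r - 2 + 2*i) choose (r - 2))) + q"
    using card_tower[of n m q] by (simp add: r)
  show ?thesis
  proof (cases "even (n - r)")
    case True
    then obtain k where k: "n - r = 2*k" by blast
    have "k = q + 1" using k assms by (simp add: q_def)
    then have n: "n = m + 2*q + 4" using k assms r by simp
    obtain G where G: "covering (n - 2) m G" "card G = C (n - 2) m"
      using minimum_covering_exists[of m "n - 2"] n by auto
    let ?T = "(\<lambda>B. B \<union> {n - 1, n}) ` G"
    have "finite G"
      using G by (intro finite_subset[of G "Pow {1..n - 2}"]) (auto simp: covering_def)
    then have "card ?T \<le> C (n - 2) m"
      using card_image_le[of G] G(2) by metis
    then have "card (tower n m q \<union> ?T) \<le> card (tower n m q) + C (n - 2) m"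
      using card_Un_le[of "tower n m q" ?T] by linarith
    moreover have "CC n r \<le> card (tower n m q \<union> ?T)"
      using CC_le[OF capped_tower_connected_covering[of m q G]] G n r by simp
    ultimately show ?thesis
      using card True unfolding N_def q_def[symmetric] by (simp add: m_def)
  next
    case False
    then obtain k where k: "n - r = 2*k + 1" by (rule oddE)
    have "real (n - r) / 2 = real k + 1/2" using k by simp
    then have "\<lceil>real (n - r) / 2\<rceil> = int k + 1" by (simp add: ceiling_eq_iff)
    then have "k = q" by (simp add: q_def)
    then have n: "n = m + 2*q + 3" using k assms r by simp
    have "CC n r \<le> card (tower n m q)"
      using CC_le[OF tower_connected_covering[of m q]] n r by simp
    then show ?thesis
      using card False unfolding N_def q_def[symmetric] by simp
  qed
qed

end
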